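(* Suppose that every ideal clutter $\mathcal{C}$ has a $\frac14$-integral packing of value $\tau(\mathcal{C})$. Then every $5$-wise intersecting clutter is non-ideal (i.e. not ideal).
   Context: Let $V$ be a finite set of elements. A family $\mathcal{C}$ of subsets of $V$ (called members) is a clutter over ground set $V$ if no member contains another one. A cover of $\mathcal{C}$ is a subset $B\subseteq V$ with $B\cap C\ne\emptyset$ for all $C\in\mathcal{C}$; the covering number $\tau(\mathcal{C})$ is the minimum cardinality of a cover. $\mathcal{C}$ is ideal if for every $w\in\mathbb{Z}^V_+$ the linear program $\min\{w^\top x : \sum_{u\in C}x_u\ge 1\ \forall C\in\mathcal{C},\ x\ge \mathbf{0}\}$ has an integral optimal solution. A fractional packing of $\mathcal{C}$ is a vector $y\in\mathbb{R}^{\mathcal{C}}_+$ such that $\sum(y_C : v\in C\in\mathcal{C})\le 1$ for all $v\in V$; its value is $\mathbf{1}^\top y$. A $\frac14$-integral packing is a fractional packing each of whose entries is an integer multiple of $\frac14$. $\mathcal{C}$ is $k$-wise intersecting if every subset of at most $k$ members have a common element (in $V$), yet no element of $V$ belongs to all members. *)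

theory Defs
  imports Complex_Main
begin

definition clutter :: "'a set \<Rightarrow> 'a set set \<Rightarrow> bool" where
  "clutter V \<C> \<longleftrightarrow> finite V \<and> \<C> \<subseteq> Pow V \<and> (\<forall>A\<in>\<C>. \<forall>B\<in>\<C>. A \<subseteq> B \<longrightarrow> A = B)"

definition is_cover :: "'a set \<Rightarrow> 'a set set \<Rightarrow> 'a set \<Rightarrow> bool" where
  "is_cover V \<C> B \<longleftrightarrow> B \<subseteq> V \<and> (\<forall>C\<in>\<C>. B \<inter> C \<noteq> {})"

text \<open>The clutter whose only member is the empty set has no cover, and the value below is
  then unspecified. That clutter is not ideal, since its covering program is infeasible.\<close>

definition covering_number :: "'a set \<Rightarrow> 'a set set \<Rightarrow> nat" where
  "covering_number V \<C> = Min (card ` {B. is_cover V \<C> B})"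

text \<open>Vectors indexed by the ground set (or by the members) are total functions of which only
  the values on the ground set (or on the members) are used.\<close>

definition covering_feasible :: "'a set \<Rightarrow> 'a set set \<Rightarrow> ('a \<Rightarrow> real) \<Rightarrow> bool" where
  "covering_feasible V \<C> x \<longleftrightarrow> (\<forall>C\<in>\<C>. (\<Sum>u\<in>C. x u) \<ge> 1) \<and> (\<forall>v\<in>V. x v \<ge> 0)"

definition covering_optimal :: "'a set \<Rightarrow> 'a set set \<Rightarrow> ('a \<Rightarrow> int) \<Rightarrow> ('a \<Rightarrow> real) \<Rightarrow> bool" where
  "covering_optimal V \<C> w x \<longleftrightarrow> covering_feasible V \<C> x \<and>
     (\<forall>x'. covering_feasible V \<C> x' \<longrightarrow>
        (\<Sum>v\<in>V. of_int (w v) * x v) \<le> (\<Sum>v\<in>V. of_int (w v) * x' v))"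

definition ideal :: "'a set \<Rightarrow> 'a set set \<Rightarrow> bool" where
  "ideal V \<C> \<longleftrightarrow> (\<forall>w :: 'a \<Rightarrow> int. (\<forall>v\<in>V. w v \<ge> 0) \<longrightarrow>
     (\<exists>x. covering_optimal V \<C> w x \<and> (\<forall>v\<in>V. x v \<in> \<int>)))"

definition fractional_packing :: "'a set \<Rightarrow> 'a set set \<Rightarrow> ('a set \<Rightarrow> real) \<Rightarrow> bool" where
  "fractional_packing V \<C> y \<longleftrightarrow>
     (\<forall>C\<in>\<C>. y C \<ge> 0) \<and> (\<forall>v\<in>V. (\<Sum>C | C \<in> \<C> \<and> v \<in> C. y C) \<le> 1)"

definition quarter_integral_packing :: "'a set \<Rightarrow> 'a set set \<Rightarrow> ('a set \<Rightarrow> real) \<Rightarrow> bool" where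
  "quarter_integral_packing V \<C> y \<longleftrightarrow>
     fractional_packing V \<C> y \<and> (\<forall>C\<in>\<C>. \<exists>m::int. y C = of_int m * (1/4))"

definition packing_value :: "'a set set \<Rightarrow> ('a set \<Rightarrow> real) \<Rightarrow> real" where
  "packing_value \<C> y = (\<Sum>C\<in>\<C>. y C)"

text \<open>The empty subset of members is included, so the first condition forces the ground set to
  be nonempty. This only matters for the clutter without members over the empty ground set,
  which is thereby not \<open>k\<close>-wise intersecting.\<close>

definition k_wise_intersecting :: "nat \<Rightarrow> 'a set \<Rightarrow> 'a set set \<Rightarrow> bool" where
  "k_wise_intersecting k V \<C> \<longleftrightarrow>
     (\<forall>\<S>\<subseteq>\<C>. finite \<S> \<and> card \<S> \<le> k \<longrightarrow> (\<exists>v\<in>V. \<forall>C\<in>\<S>. v \<in> C)) \<and>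
     \<not> (\<exists>v\<in>V. \<forall>C\<in>\<C>. v \<in> C)"

end

theory Submission
  imports Defs
begin

text \<open>
  A clutter \<open>\<C>\<close> that is \<open>k\<close>-wise intersecting for some \<open>k \<ge> 1\<close> has covering number at least two: it
  has a member, so the empty set is no cover, and no single element meets all the members. If
  \<open>\<C>\<close> were ideal, the hypothesis would give it a quarter-integral packing \<open>y\<close> of value at least two.
  If at least five members have positive weight, any five of them have total weight at least
  \<open>5/4\<close>; otherwise the support of \<open>y\<close> has at most four members and total weight at least two.
  In both cases at most five members have total weight greater than one
  (lemma \<open>few_members_of_weight_gt_1\<close>). An element common to all of them would be overloaded by the
  packing, so \<open>\<C>\<close> is not five-wise intersecting.

  The hypothesis speaks of clutters over sets of natural numbers. The ground set is finite, hence
  in bijection with such a set, and idealness and the intersection property are invariant under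
  renaming elements (lemmas \<open>ideal_image\<close> and \<open>k_wise_intersecting_image\<close>).
\<close>

text \<open>With weights that are zero or at least \<open>1/k\<close>, the support either has at most \<open>k\<close> members, and
  then carries the whole weight, or contains \<open>k + 1\<close> members, and these weigh \<open>(k + 1)/k\<close> or more.\<close>

lemma few_members_of_weight_gt_1:
  fixes y :: "'b \<Rightarrow> real"
  assumes "finite A" and "k > 0"
    and gap: "\<And>a. a \<in> A \<Longrightarrow> y a = 0 \<or> y a \<ge> 1 / real k"
    and total: "(\<Sum>a\<in>A. y a) > 1"
  obtains S where "S \<subseteq> A" "card S \<le> Suc k" "(\<Sum>a\<in>S. y a) > 1"
proof -
  define P where "P = {a \<in> A. y a \<noteq> 0}"
  have "(\<Sum>a\<in>P. y a) = (\<Sum>a\<in>A. y a)"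
    using assms(1) by (intro sum.mono_neutral_left) (auto simp: P_def)
  then have P: "finite P" "P \<subseteq> A" "(\<Sum>a\<in>P. y a) > 1"
    using assms(1) total by (auto simp: P_def)
  show thesis
  proof (cases "card P \<le> Suc k")
    case True
    with P that show thesis by blast
  next
    case False
    then obtain S where S: "S \<subseteq> P" "card S = Suc k"
      using obtain_subset_with_card_n[of "Suc k" P] by auto
    have "1 < real (card S) * (1 / real k)"
      using \<open>k > 0\<close> S by (simp add: field_simps)
    also have "\<dots> \<le> (\<Sum>a\<in>S. y a)"
      using S gap by (intro sum_bounded_below) (auto simp: P_def)
    finally show thesis using that[of S] S P by auto
  qed
qed

lemma packing_not_k_wise_intersecting:
  assumes "finite \<C>" and "k > 0"
    and pack: "fractional_packing V \<C> y"
    and gap: "\<And>C. C \<in> \<C> \<Longrightarrow> y C = 0 \<or> y C \<ge> 1 / real k"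
    and "packing_value \<C> y > 1"
  shows "\<not> k_wise_intersecting (Suc k) V \<C>"
proof
  assume k_wise: "k_wise_intersecting (Suc k) V \<C>"
  obtain S where S: "S \<subseteq> \<C>" "card S \<le> Suc k" "(\<Sum>C\<in>S. y C) > 1"
    by (rule few_members_of_weight_gt_1[of \<C> k y])
      (use assms(1,2,5) gap in \<open>auto simp: packing_value_def\<close>)
  with k_wise \<open>finite \<C>\<close> obtain v where v: "v \<in> V" "\<forall>C\<in>S. v \<in> C"
    unfolding k_wise_intersecting_def by (meson finite_subset)
  have "(\<Sum>C\<in>S. y C) \<le> (\<Sum>C | C \<in> \<C> \<and> v \<in> C. y C)"
    using \<open>finite \<C>\<close> pack S v by (intro sum_mono2) (auto simp: fractional_packing_def)
  also have "\<dots> \<le> 1"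
    using pack v by (auto simp: fractional_packing_def)
  finally show False using S by simp
qed

lemma covering_number_ge_2:
  assumes "clutter V \<C>" and "k_wise_intersecting k V \<C>" and "k > 0"
  shows "covering_number V \<C> \<ge> 2"
proof -
  have fin: "finite V"
    using assms(1) by (simp add: clutter_def)
  have meet: "\<exists>v\<in>V. \<forall>C\<in>S. v \<in> C" if "S \<subseteq> \<C>" "finite S" "card S \<le> k" for S
    using assms(2) that by (auto simp: k_wise_intersecting_def)
  have no_common: "\<not> (\<exists>v\<in>V. \<forall>C\<in>\<C>. v \<in> C)"
    using assms(2) by (auto simp: k_wise_intersecting_def)
  have "V \<inter> C \<noteq> {}" if "C \<in> \<C>" for C
    using meet[of "{C}"] that \<open>k > 0\<close> by auto
  then have "is_cover V \<C> V" by (auto simp: is_cover_def)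
  moreover have "finite {B. is_cover V \<C> B}"
    using fin by (auto simp: is_cover_def intro: finite_subset[of _ "Pow V"])
  moreover have "card B \<ge> 2" if B: "is_cover V \<C> B" for B
  proof (rule ccontr)
    assume "\<not> card B \<ge> 2"
    moreover have "finite B" using B fin by (auto simp: is_cover_def intro: finite_subset)
    moreover
    \<comment> \<open>This serves the empty cover of a clutter without members: an element is still needed
      to contradict the absence of a common one.\<close>
    have "V \<noteq> {}" using meet[of "{}"] by auto
    ultimately have "\<exists>v\<in>V. B \<subseteq> {v}"
      using B by (auto simp: is_cover_def card_1_singleton_iff not_le numeral_2_eq_2 less_Suc_eq)
    then obtain v where "v \<in> V" "B \<subseteq> {v}" by blast
    then have "\<forall>C\<in>\<C>. v \<in> C" using B unfolding is_cover_def by blast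
    with \<open>v \<in> V\<close> no_common show False by blast
  qed
  ultimately show ?thesis
    unfolding covering_number_def by (subst Min_ge_iff) auto
qed

lemma clutter_image:
  assumes "inj_on f V" and "clutter V \<C>"
  shows "clutter (f ` V) ((`) f ` \<C>)"
proof -
  have "A \<subseteq> B" if "A \<in> \<C>" "B \<in> \<C>" "f ` A \<subseteq> f ` B" for A B
  proof
    fix a assume "a \<in> A"
    moreover from this have "f a \<in> f ` B" using that(3) by blast
    moreover have "A \<subseteq> V" "B \<subseteq> V" using assms(2) that by (auto simp: clutter_def)
    ultimately show "a \<in> B" using assms(1) inj_on_image_mem_iff[of f V a B] by auto
  qed
  then have "f ` A = f ` B" if "A \<in> \<C>" "B \<in> \<C>" "f ` A \<subseteq> f ` B" for A B
    using assms(2) that unfolding clutter_def by metis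
  moreover have "(`) f ` \<C> \<subseteq> Pow (f ` V)"
    using assms(2) by (auto simp: clutter_def)
  ultimately show ?thesis using assms(2) by (simp add: clutter_def)
qed

lemma k_wise_intersecting_image:
  assumes inj: "inj_on f V" and sub: "\<C> \<subseteq> Pow V" and k_wise: "k_wise_intersecting k V \<C>"
  shows "k_wise_intersecting k (f ` V) ((`) f ` \<C>)"
proof -
  have mem: "f v \<in> f ` C \<longleftrightarrow> v \<in> C" if "v \<in> V" "C \<in> \<C>" for v C
    using inj sub that by (intro inj_on_image_mem_iff) auto
  have inj': "inj_on ((`) f) \<C>"
    using inj sub by (meson inj_on_image_Pow inj_on_subset)
  have "\<exists>v\<in>V. \<forall>D\<in>S. f v \<in> D"
    if S: "S \<subseteq> (`) f ` \<C>" "finite S" "card S \<le> k" for S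
  proof -
    obtain T where T: "T \<subseteq> \<C>" "S = (`) f ` T"
      using S by (meson subset_imageE)
    then have "inj_on ((`) f) T" using inj' inj_on_subset by blast
    then have "finite T" "card T \<le> k"
      using S T by (auto simp: finite_image_iff card_image)
    with k_wise T obtain v where "v \<in> V" "\<forall>C\<in>T. v \<in> C"
      unfolding k_wise_intersecting_def by blast
    with T show ?thesis by auto
  qed
  moreover have "\<not> (\<exists>v\<in>V. \<forall>C\<in>\<C>. f v \<in> f ` C)"
    using k_wise mem by (auto simp: k_wise_intersecting_def)
  ultimately show ?thesis unfolding k_wise_intersecting_def by simp
qed

lemma covering_feasible_image:
  assumes "inj_on f V" and "\<C> \<subseteq> Pow V"
  shows "covering_feasible (f ` V) ((`) f ` \<C>) x \<longleftrightarrow> covering_feasible V \<C> (x \<circ> f)"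
proof -
  have "(\<Sum>u\<in>f ` C. x u) = (\<Sum>u\<in>C. (x \<circ> f) u)" if "C \<in> \<C>" for C
    using assms that by (intro sum.reindex) (auto intro: inj_on_subset)
  then show ?thesis by (auto simp: covering_feasible_def)
qed

lemma covering_feasible_cong:
  assumes "\<C> \<subseteq> Pow V" and "\<And>v. v \<in> V \<Longrightarrow> x v = x' v"
  shows "covering_feasible V \<C> x \<longleftrightarrow> covering_feasible V \<C> x'"
proof -
  have "(\<Sum>u\<in>C. x u) = (\<Sum>u\<in>C. x' u)" if "C \<in> \<C>" for C
    using assms that by (intro sum.cong) auto
  with assms(2) show ?thesis by (simp add: covering_feasible_def)
qed

lemma ideal_image:
  assumes inj: "inj_on f V" and sub: "\<C> \<subseteq> Pow V" and "ideal V \<C>"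
  shows "ideal (f ` V) ((`) f ` \<C>)"
  unfolding ideal_def
proof (intro allI impI)
  fix w :: "'b \<Rightarrow> int"
  assume "\<forall>v\<in>f ` V. w v \<ge> 0"
  then have "\<forall>v\<in>V. (w \<circ> f) v \<ge> 0" by simp
  then obtain x where x: "covering_optimal V \<C> (w \<circ> f) x" "\<forall>v\<in>V. x v \<in> \<int>"
    using \<open>ideal V \<C>\<close> unfolding ideal_def by blast
  define x' where "x' = x \<circ> inv_into V f"
  have x': "x' (f v) = x v" if "v \<in> V" for v
    using inj that by (simp add: x'_def)
  have value_image: "(\<Sum>v\<in>f ` V. of_int (w v) * z v) = (\<Sum>v\<in>V. of_int ((w \<circ> f) v) * (z \<circ> f) v)"
    for z :: "'b \<Rightarrow> real"
    by (simp add: sum.reindex[OF inj])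
  have "covering_feasible V \<C> (x' \<circ> f) \<longleftrightarrow> covering_feasible V \<C> x"
    using sub x' by (intro covering_feasible_cong) auto
  moreover have "(\<Sum>v\<in>V. of_int ((w \<circ> f) v) * (x' \<circ> f) v) = (\<Sum>v\<in>V. of_int ((w \<circ> f) v) * x v)"
    using x' by (intro sum.cong) auto
  ultimately have "covering_optimal (f ` V) ((`) f ` \<C>) w x'"
    using x(1) unfolding covering_optimal_def covering_feasible_image[OF inj sub] value_image
    by auto
  with x x' show "\<exists>x. covering_optimal (f ` V) ((`) f ` \<C>) w x \<and> (\<forall>v\<in>f ` V. x v \<in> \<int>)"
    by (intro exI[of _ x']) auto
qed

theorem proposition7:
  fixes V :: "'a set" and \<C> :: "'a set set"
  assumes "\<And>(W :: nat set) (\<D> :: nat set set). clutter W \<D> \<Longrightarrow> ideal W \<D> \<Longrightarrow>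
      \<exists>y. quarter_integral_packing W \<D> y \<and> packing_value \<D> y = real (covering_number W \<D>)"
    and "clutter V \<C>"
    and "k_wise_intersecting 5 V \<C>"
  shows "\<not> ideal V \<C>"
proof
  assume "ideal V \<C>"
  have sub: "\<C> \<subseteq> Pow V" and "finite V"
    using assms(2) by (auto simp: clutter_def)
  then obtain f :: "'a \<Rightarrow> nat" where inj: "inj_on f V"
    using finite_imp_inj_to_nat_seg by blast
  define W \<D> where "W = f ` V" and "\<D> = (`) f ` \<C>"
  have clutter: "clutter W \<D>"
    unfolding W_def \<D>_def using inj assms(2) by (rule clutter_image)
  have k_wise: "k_wise_intersecting (Suc 4) W \<D>"
    using k_wise_intersecting_image[OF inj sub assms(3)] by (simp add: W_def \<D>_def)
  have "ideal W \<D>"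
    unfolding W_def \<D>_def using inj sub \<open>ideal V \<C>\<close> by (rule ideal_image)
  with clutter obtain y where y: "quarter_integral_packing W \<D> y"
    and val: "packing_value \<D> y = real (covering_number W \<D>)"
    using assms(1) by blast
  have "y D = 0 \<or> y D \<ge> 1 / real 4" if "D \<in> \<D>" for D
  proof -
    have "y D \<ge> 0" "\<exists>m::int. y D = of_int m * (1/4)"
      using y that by (simp_all add: quarter_integral_packing_def fractional_packing_def)
    then obtain m :: int where "y D = of_int m * (1/4)" "y D \<ge> 0" by blast
    then show ?thesis by (cases "m = 0") auto
  qed
  moreover have "finite \<D>"
    using \<open>finite V\<close> sub by (auto simp: \<D>_def intro: finite_subset)
  moreover have "fractional_packing W \<D> y"
    using y by (simp add: quarter_integral_packing_def)
  moreover have "packing_value \<D> y > 1"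
    using covering_number_ge_2[OF clutter k_wise] val by simp
  ultimately show False
    using packing_not_k_wise_intersecting[of \<D> 4 W y] k_wise by simp
qed

end
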